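(* Let $\beta \ge 1$, $w_0 > 0$, and let $a, b \in \mathbb{R}$ with $a + 1 < b$. Suppose $u \in C^0([a,b]) \cap C^1([a+1,b])$ is a real-valued function such that $$u(t) < 1 \quad \text{for all } t \in [a,a+1],$$ and $$\frac{du}{dt}(t) = w_0\,|1 - u(t-1)|^\beta \quad \text{for all } a+1 \le t \le b.$$ If there exists $t_* \in (a+1,b)$ such that $u(t_* ) = 1$, then $\frac{du}{dt}(t_* ) > 0$, and $$u(t) < 1 \ \text{ for } a \le t < t_*, \qquad u(t_* ) = 1, \qquad u(t) > 1 \ \text{ for } t_* < t \le b.$$
   Context: $u \in C^0([a,b]) \cap C^1([a+1,b])$ means that $u$ is continuous on $[a,b]$ and its restriction to $[a+1,b]$ is continuously differentiable, with derivatives at the endpoints $a+1$ and $b$ understood as one-sided derivatives from within $[a+1,b]$. *)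

theory Defs
  imports Complex_Main
begin

end

theory Submission
  imports Defs "HOL-Analysis.Derivative"
begin

text \<open>
  On \<open>[a+1, b]\<close> the derivative is \<open>w\<^sub>0\<close> times a nonnegative number, so \<open>u\<close> is nondecreasing there.
  Let \<open>\<tau>\<close> be the first time at which \<open>u\<close> equals \<open>1\<close>. For \<open>a + 1 \<le> t < \<tau> + 1\<close> the delayed
  value \<open>u (t - 1)\<close> is taken before \<open>\<tau>\<close>, hence strictly below \<open>1\<close>, and the equation forces
  \<open>u' t > 0\<close>. Thus \<open>u\<close> crosses the level \<open>1\<close> with positive slope and keeps increasing strictly for
  one more unit of time; monotonicity then keeps it above \<open>1\<close> up to \<open>b\<close>. In particular \<open>1\<close> is
  attained only at \<open>\<tau>\<close>, so any given crossing time is the first one. The delay is what makes the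
  argument work: the sign of \<open>u'\<close> just after \<open>\<tau>\<close> depends only on values of \<open>u\<close> before \<open>\<tau>\<close>.
\<close>

lemma real_mvt_within_subinterval:
  fixes f f' :: "real \<Rightarrow> real"
  assumes "\<And>t. t \<in> {c..d} \<Longrightarrow> (f has_real_derivative f' t) (at t within {c..d})"
    and "c \<le> x" "x < y" "y \<le> d"
  obtains z where "x < z" "z < y" "f y - f x = f' z * (y - x)"
proof -
  have "(f has_derivative (*) (f' t)) (at t within {x..y})" if "x \<le> t" "t \<le> y" for t
    using has_derivative_subset[OF assms(1)[of t, unfolded has_field_derivative_def]] that assms(2-4)
    by auto
  from mvt_simple[OF \<open>x < y\<close> this] show ?thesis
    using that by auto
qed

text \<open>
  The level set is compact, hence contains its infimum; before that time the intermediate value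
  theorem excludes values at or above the level.
\<close>

lemma first_hitting_time:
  fixes f :: "real \<Rightarrow> real"
  assumes cont: "continuous_on {a..b} f" and below: "f a < l"
    and hit: "s \<in> {a..b}" "f s = l"
  obtains \<tau> where "a < \<tau>" "\<tau> \<le> b" "f \<tau> = l" "\<And>t. a \<le> t \<Longrightarrow> t < \<tau> \<Longrightarrow> f t < l"
proof -
  let ?S = "f -` {l} \<inter> {a..b}"
  have "closed ?S"
    using cont continuous_on_closed_vimage[of "{a..b}" f] by auto
  moreover have "?S = {a..b} \<inter> ?S" by auto
  ultimately have "compact ?S"
    by (metis compact_Icc compact_Int_closed)
  moreover have "?S \<noteq> {}" using hit by auto
  ultimately obtain \<tau> where \<tau>: "\<tau> \<in> ?S" and first: "\<And>t. t \<in> ?S \<Longrightarrow> \<tau> \<le> t"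
    using compact_attains_inf by metis
  have "f t < l" if t: "a \<le> t" "t < \<tau>" for t
  proof (rule ccontr)
    assume "\<not> f t < l"
    moreover have "continuous_on {a..t} f"
      using cont t \<tau> by (auto intro: continuous_on_subset)
    ultimately obtain x where "a \<le> x" "x \<le> t" "f x = l"
      using IVT'[of f a l t] below t by auto
    then show False using first[of x] t \<tau> by auto
  qed
  moreover have "a < \<tau>"
    using \<tau> below by (cases "\<tau> = a") auto
  ultimately show ?thesis using \<tau> that by auto
qed

theorem theorem3p2:
  fixes \<beta> w\<^sub>0 a b tstar :: real and u u' :: "real \<Rightarrow> real"
  assumes "\<beta> \<ge> 1" and "w\<^sub>0 > 0" and "a + 1 < b"
    and "continuous_on {a..b} u"
    and "\<And>t. t \<in> {a+1..b} \<Longrightarrow> (u has_real_derivative u' t) (at t within {a+1..b})"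
    and "continuous_on {a+1..b} u'"
    and "\<And>t. t \<in> {a..a+1} \<Longrightarrow> u t < 1"
    and "\<And>t. t \<in> {a+1..b} \<Longrightarrow> u' t = w\<^sub>0 * \<bar>1 - u (t - 1)\<bar> powr \<beta>"
    and "tstar \<in> {a+1<..<b}" and "u tstar = 1"
  shows "u' tstar > 0 \<and> (\<forall>t\<in>{a..<tstar}. u t < 1) \<and> u tstar = 1 \<and> (\<forall>t\<in>{tstar<..b}. u t > 1)"
proof -
  note deriv = assms(5) and eq = assms(8)
  have mono: "u x \<le> u y" if xy: "a + 1 \<le> x" "x \<le> y" "y \<le> b" for x y
  proof (cases "x = y")
    case False
    with xy have "x < y" by simp
    then obtain z where z: "x < z" "z < y" "u y - u x = u' z * (y - x)"
      using real_mvt_within_subinterval[of "a+1" b u u' x y] deriv xy by auto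
    have "u' z \<ge> 0"
      using eq[of z] z xy \<open>w\<^sub>0 > 0\<close> by simp
    then show ?thesis
      using z xy by (smt (verit) mult_nonneg_nonneg)
  qed simp
  obtain \<tau> where \<tau>: "a < \<tau>" "\<tau> \<le> b" "u \<tau> = 1"
    and before: "\<And>t. a \<le> t \<Longrightarrow> t < \<tau> \<Longrightarrow> u t < 1"
    using first_hitting_time[of a b u 1 tstar] assms(4,7,9,10) by auto
  have "a + 1 < \<tau>"
    using assms(7)[of \<tau>] \<tau> by force
  have slope: "u' t > 0" if "a + 1 \<le> t" "t \<le> b" "t < \<tau> + 1" for t
    using before[of "t - 1"] eq[of t] that \<open>w\<^sub>0 > 0\<close> by auto
  have after: "u t > 1" if t: "\<tau> < t" "t \<le> b" for t
  proof -
    \<comment> \<open>\<open>u\<close> is known to increase strictly only up to one delay after \<open>\<tau>\<close>; beyond that, monotonicity suffices.\<close>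
    define s where "s = min t (\<tau> + 1)"
    have s: "\<tau> < s" "s \<le> t" "s \<le> \<tau> + 1"
      using t by (auto simp: s_def)
    then obtain z where z: "\<tau> < z" "z < s" "u s - u \<tau> = u' z * (s - \<tau>)"
      using real_mvt_within_subinterval[of "a+1" b u u' \<tau> s] deriv \<open>a + 1 < \<tau>\<close> t by auto
    have "u' z > 0"
      using slope[of z] z s t \<open>a + 1 < \<tau>\<close> by simp
    then have "u s > 1"
      using z s \<tau> by (smt (verit) mult_pos_pos)
    also have "u s \<le> u t"
      using mono[of s t] s t \<open>a + 1 < \<tau>\<close> by simp
    finally show ?thesis .
  qed
  have "tstar = \<tau>"
    using before[of tstar] after[of tstar] assms(9,10) by force
  then show ?thesis
    using slope[of \<tau>] before after \<tau> \<open>a + 1 < \<tau>\<close> by auto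
qed

end
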